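(* Every regular bipartite graph, every tree, and every complete bipartite graph $K_{m,n}$ ($m,n\geq 1$) belongs to $\mathfrak{T}$, i.e. has an interval total $t$-coloring for some $t\geq 1$.
   Context: All graphs are finite, undirected, without loops or multiple edges. A total coloring of a graph $G$ is an assignment of colors to the vertices and edges of $G$ such that no two adjacent vertices, no two adjacent edges, and no vertex and an edge incident to it receive the same color. For a positive integer $t$, an interval total $t$-coloring of $G$ is a total coloring of $G$ with colors $1,2,\ldots,t$ such that each color $i\in\{1,\ldots,t\}$ is used on at least one vertex or edge, and for each vertex $v$ the set consisting of the color of $v$ and the colors of the edges incident to $v$ consists of $d_G(v)+1$ consecutive integers, where $d_G(v)$ is the degree of $v$. $\mathfrak{T}_t$ denotes the set of graphs having an interval total $t$-coloring, and $\mathfrak{T}=\bigcup_{t\geq 1}\mathfrak{T}_t$. *)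

theory Defs
  imports "Graph_Theory.Kuratowski"
begin

text \<open>
  A finite simple graph is a \<^locale>\<open>pair_graph\<close>: its arc set is a symmetric irreflexive relation,
  and each undirected edge is represented by the two arcs (u,v) and (v,u). Since both arcs have to
  carry the same color, edges are taken as two-element vertex sets.
\<close>

definition edges :: "'a pair_pre_digraph \<Rightarrow> 'a set set" where
  "edges G = {{u, v} |u v. (u, v) \<in> parcs G}"

definition incident_edges :: "'a pair_pre_digraph \<Rightarrow> 'a \<Rightarrow> 'a set set" where
  "incident_edges G v = {e \<in> edges G. v \<in> e}"

definition degree :: "'a pair_pre_digraph \<Rightarrow> 'a \<Rightarrow> nat" where
  "degree G v = card (incident_edges G v)"

definition regular :: "'a pair_pre_digraph \<Rightarrow> bool" where
  "regular G \<longleftrightarrow> (\<exists>r. \<forall>v\<in>pverts G. degree G v = r)"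

definition bipartite :: "'a pair_pre_digraph \<Rightarrow> bool" where
  "bipartite G \<longleftrightarrow> (\<exists>X Y. pverts G = X \<union> Y \<and> X \<inter> Y = {} \<and> parcs G \<subseteq> X \<times> Y \<union> Y \<times> X)"

text \<open>
  The library predicate \<^const>\<open>tree\<close> is unsuitable here: in a symmetric digraph the walk a, b, a
  already counts as a cycle, so it would exclude every graph with an edge. The cycles of a simple
  undirected graph are exactly the directed cycles of length at least 3. Connectedness
  includes that there is at least one vertex.
\<close>

definition undirected_tree :: "'a pair_pre_digraph \<Rightarrow> bool" where
  "undirected_tree G \<longleftrightarrow>
     connected (with_proj G) \<and> \<not> (\<exists>p. pre_digraph.cycle (with_proj G) p \<and> 3 \<le> length p)"

text \<open>A coloring is a pair of functions: \<open>cv\<close> on the vertices and \<open>ce\<close> on the edges.\<close>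

definition total_coloring ::
    "'a pair_pre_digraph \<Rightarrow> ('a \<Rightarrow> nat) \<Rightarrow> ('a set \<Rightarrow> nat) \<Rightarrow> bool" where
  "total_coloring G cv ce \<longleftrightarrow>
     (\<forall>(u, v) \<in> parcs G. cv u \<noteq> cv v) \<and>
     (\<forall>e\<in>edges G. \<forall>f\<in>edges G. e \<noteq> f \<and> e \<inter> f \<noteq> {} \<longrightarrow> ce e \<noteq> ce f) \<and>
     (\<forall>v\<in>pverts G. \<forall>e\<in>incident_edges G v. cv v \<noteq> ce e)"

definition interval_total_coloring ::
    "'a pair_pre_digraph \<Rightarrow> nat \<Rightarrow> ('a \<Rightarrow> nat) \<Rightarrow> ('a set \<Rightarrow> nat) \<Rightarrow> bool" where
  "interval_total_coloring G t cv ce \<longleftrightarrow>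
     total_coloring G cv ce \<and>
     cv ` pverts G \<union> ce ` edges G = {1..t} \<and>
     (\<forall>v\<in>pverts G. \<exists>k. insert (cv v) (ce ` incident_edges G v) = {k..<k + (degree G v + 1)})"

definition interval_total_colorable_with :: "nat \<Rightarrow> 'a pair_pre_digraph set" ("\<TT>\<^bsub>_\<^esub>") where
  "\<TT>\<^bsub>t\<^esub> = {G. pair_graph G \<and> (\<exists>cv ce. interval_total_coloring G t cv ce)}"

definition interval_total_colorable :: "'a pair_pre_digraph set" ("\<TT>") where
  "\<TT> = (\<Union>t\<in>{1..}. \<TT>\<^bsub>t\<^esub>)"

end

theory Submission
  imports Defs
begin

text \<open>
  For an \<open>r\<close>-regular bipartite graph, take a proper edge coloring with \<open>r\<close> colors (Koenig), use
  \<open>2, \<dots>, r + 1\<close> for the edges, and give one side the color \<open>1\<close> and the other side \<open>r + 2\<close>.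
  In \<open>K\<^sub>m\<^sub>,\<^sub>n\<close> with sides \<open>u\<^sub>1, \<dots>, u\<^sub>m\<close> and \<open>v\<^sub>1, \<dots>, v\<^sub>n\<close>, color \<open>u\<^sub>i\<close> with \<open>i\<close>, \<open>v\<^sub>j\<close> with \<open>m + 1 + j\<close>,
  and the edge between them with \<open>i + j\<close>.
  A tree is colored leaf by leaf: if the colors at \<open>v\<close> end in \<open>s\<close>, a new leaf at \<open>v\<close> gets an edge of
  color \<open>s + 1\<close> and the vertex color \<open>s + 2\<close>.
\<close>

subsection \<open>Colorings of arcs\<close>

definition nbrs :: "'a pair_pre_digraph \<Rightarrow> 'a \<Rightarrow> 'a set" where
  "nbrs G v = parcs G `` {v}"

lemma pair_graph_symD: "pair_graph G \<Longrightarrow> (u, v) \<in> parcs G \<Longrightarrow> (v, u) \<in> parcs G"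
  using arcs_ends_symmetric[of "with_proj G"] pair_sym_digraph.pair_sym_arcs[of G]
  by (metis pair_graph_def pair_pseudo_graph_def with_proj_simps(3))

lemma pair_graph_irreflD: "pair_graph G \<Longrightarrow> (u, u) \<notin> parcs G"
  using pair_loopfree_digraph.no_loops'[of G u u]
  by (metis pair_graph_def pair_digraph_def)

lemma pair_graph_vertsD:
  assumes "pair_graph G" "(u, v) \<in> parcs G"
  shows "u \<in> pverts G" "v \<in> pverts G"
  using assms pair_wf_digraph.in_arcsD1[of G] pair_wf_digraph.in_arcsD2[of G]
  by (meson pair_digraph.pair_wf_digraph pair_graph_def)+

lemma pair_graph_finite:
  assumes "pair_graph G"
  shows "finite (pverts G)" "finite (parcs G)"
  using assms pair_fin_digraph.pair_finite_verts pair_fin_digraph.pair_finite_arcs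
  by (meson pair_digraph_def pair_graph_def)+

lemma pair_graphI:
  assumes "finite (pverts G)" "parcs G \<subseteq> pverts G \<times> pverts G"
    "\<And>u v. (u, v) \<in> parcs G \<Longrightarrow> (v, u) \<in> parcs G" "\<And>u. (u, u) \<notin> parcs G"
  shows "pair_graph G"
proof
  show "finite (parcs G)"
    using assms(1,2) by (meson finite_SigmaI finite_subset)
qed (use assms in \<open>auto simp: symmetric_def intro!: symI\<close>)

lemma finite_nbrs: "pair_graph G \<Longrightarrow> finite (nbrs G v)"
  by (auto simp: nbrs_def dest: pair_graph_finite(2) intro: finite_Image)

lemma incident_edges_eq:
  assumes "pair_graph G"
  shows "incident_edges G v = (\<lambda>w. {v, w}) ` nbrs G v"
  using pair_graph_symD[OF assms]
  by (fastforce simp: incident_edges_def edges_def nbrs_def)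

lemma degree_eq:
  assumes "pair_graph G"
  shows "degree G v = card (nbrs G v)"
  unfolding degree_def incident_edges_eq[OF assms]
  by (rule card_image) (auto simp: inj_on_def doubleton_eq_iff)

lemma edges_eq: "edges G = (\<lambda>(u, v). {u, v}) ` parcs G"
  by (auto simp: edges_def)

text \<open>
  Properness at the edges comes for free: \<open>d + 1\<close> elements whose colors fill an interval of length
  \<open>d + 1\<close> have distinct colors.
\<close>

lemma interval_total_coloringI:
  assumes G: "pair_graph G"
    and cv: "\<And>u v. (u, v) \<in> parcs G \<Longrightarrow> cv u \<noteq> cv v"
    and all: "cv ` pverts G \<union> ce ` edges G = {1..t}"
    and int: "\<And>v. v \<in> pverts G \<Longrightarrow>
      \<exists>k. insert (cv v) (ce ` incident_edges G v) = {k..<k + (degree G v + 1)}"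
  shows "interval_total_coloring G t cv ce"
proof -
  have key: "cv v \<notin> ce ` incident_edges G v \<and> inj_on ce (incident_edges G v)"
    if v: "v \<in> pverts G" for v
  proof -
    have fin: "finite (incident_edges G v)"
      by (simp add: incident_edges_eq finite_nbrs G)
    obtain k where "insert (cv v) (ce ` incident_edges G v) = {k..<k + (degree G v + 1)}"
      using int[OF v] by blast
    then have card: "card (insert (cv v) (ce ` incident_edges G v)) = degree G v + 1"
      by simp
    have le: "card (ce ` incident_edges G v) \<le> degree G v"
      unfolding degree_def by (rule card_image_le[OF fin])
    have "cv v \<notin> ce ` incident_edges G v"
      using card le by (auto simp: insert_absorb)
    moreover from this have "card (ce ` incident_edges G v) = card (incident_edges G v)"
      using card fin by (simp add: degree_def)
    ultimately show ?thesis using fin by (simp add: eq_card_imp_inj_on)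
  qed
  have "ce e \<noteq> ce f" if ef: "e \<in> edges G" "f \<in> edges G" "e \<noteq> f" "e \<inter> f \<noteq> {}" for e f
  proof -
    obtain v where v: "v \<in> e" "v \<in> f" using ef(4) by blast
    then have "v \<in> pverts G"
      using ef(1) pair_graph_vertsD[OF G] by (auto simp: edges_def)
    then show ?thesis
      using key[of v] v ef by (auto simp: incident_edges_def inj_on_def)
  qed
  moreover have "cv v \<noteq> ce e" if "v \<in> pverts G" "e \<in> incident_edges G v" for v e
    using key that by (metis imageI)
  ultimately have "total_coloring G cv ce"
    using cv unfolding total_coloring_def by (intro conjI ballI impI) auto
  then show ?thesis
    using all int unfolding interval_total_coloring_def by simp
qed

text \<open>Edge colors are a symmetric function of the two ends, which is easier to build than a
  function on two-element sets. Distinctness of colors around a vertex is left to the interval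
  condition: \<open>card (nbrs G v) + 1\<close> elements have to fill an interval of that
  size.\<close>

definition interval_arc_coloring ::
    "'a pair_pre_digraph \<Rightarrow> nat \<Rightarrow> ('a \<Rightarrow> nat) \<Rightarrow> ('a \<Rightarrow> 'a \<Rightarrow> nat) \<Rightarrow> bool" where
  "interval_arc_coloring G t cv c \<longleftrightarrow>
     (\<forall>u v. (u, v) \<in> parcs G \<longrightarrow> c u v = c v u \<and> cv u \<noteq> cv v) \<and>
     cv ` pverts G \<union> case_prod c ` parcs G = {1..t} \<and>
     (\<forall>v\<in>pverts G. \<exists>k. insert (cv v) (c v ` nbrs G v) = {k..k + card (nbrs G v)})"

text \<open>All later constructions work with arc colorings and return to \<open>\<TT>\<close>
  through this equivalence. An edge coloring yields \<open>c u v = ce {u, v}\<close>; conversely the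
  symmetry of \<open>c\<close> makes the color of \<open>{u, v}\<close> well defined.\<close>

lemma interval_total_colorable_iff:
  "G \<in> \<TT> \<longleftrightarrow> pair_graph G \<and> (\<exists>t\<ge>1. \<exists>cv c. interval_arc_coloring G t cv c)"
    (is "_ \<longleftrightarrow> _ \<and> ?R")
proof
  assume "G \<in> \<TT>"
  then obtain t cv ce where G: "pair_graph G" and t: "1 \<le> t"
    and col: "interval_total_coloring G t cv ce"
    by (auto simp: interval_total_colorable_def interval_total_colorable_with_def)
  define c where "c u v = ce {u, v}" for u v
  have "case_prod c ` parcs G = ce ` edges G"
    by (simp add: edges_eq image_image c_def case_prod_unfold)
  moreover have "ce ` incident_edges G v = c v ` nbrs G v" for v
    by (simp add: incident_edges_eq[OF G] image_image c_def)
  ultimately have "interval_arc_coloring G t cv c"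
    using col
    unfolding interval_arc_coloring_def interval_total_coloring_def total_coloring_def
    by (auto simp: c_def insert_commute degree_eq[OF G] atLeastLessThanSuc_atLeastAtMost)
  with t have ?R by blast
  with G show "pair_graph G \<and> ?R" by blast
next
  assume "pair_graph G \<and> ?R"
  then obtain t cv c where G: "pair_graph G" and t: "1 \<le> t"
    and col: "interval_arc_coloring G t cv c" by blast
  have sym: "c u v = c v u" and cv: "cv u \<noteq> cv v" if "(u, v) \<in> parcs G" for u v
    using col that unfolding interval_arc_coloring_def by blast+
  have all: "cv ` pverts G \<union> case_prod c ` parcs G = {1..t}"
    and int: "\<And>v. v \<in> pverts G \<Longrightarrow>
      \<exists>k. insert (cv v) (c v ` nbrs G v) = {k..k + card (nbrs G v)}"
    using col unfolding interval_arc_coloring_def by blast+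
  \<comment> \<open>The description is unique: only the arcs \<open>(u, v)\<close> and
    \<open>(v, u)\<close> represent \<open>{u, v}\<close>, and \<open>c\<close> agrees on
    them.\<close>
  define ce where "ce e = (THE i. \<exists>u v. (u, v) \<in> parcs G \<and> e = {u, v} \<and> i = c u v)" for e
  have ce: "ce {u, v} = c u v" if "(u, v) \<in> parcs G" for u v
    unfolding ce_def using that sym[OF that] by (intro the_equality exI[of _ u] exI[of _ v]) (auto simp: doubleton_eq_iff)
  have "case_prod c ` parcs G = ce ` edges G"
    unfolding edges_eq image_image using ce by (intro image_cong) auto
  moreover have "ce ` incident_edges G v = c v ` nbrs G v" for v
    using ce by (simp add: incident_edges_eq[OF G] image_image nbrs_def)
  ultimately have "interval_total_coloring G t cv ce"
    using int all cv
    by (intro interval_total_coloringI[OF G])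
      (simp_all add: degree_eq[OF G] atLeastLessThanSuc_atLeastAtMost)
  then show "G \<in> \<TT>"
    using G t by (auto simp: interval_total_colorable_def interval_total_colorable_with_def)
qed

text \<open>Color 1 everywhere. This settles regular graphs of degree 0 and starts the induction for
  trees.\<close>

lemma edgeless_colorable:
  assumes "pair_graph G" "pverts G \<noteq> {}" "parcs G = {}"
  shows "G \<in> \<TT>"
proof -
  have "interval_arc_coloring G 1 (\<lambda>_. 1) (\<lambda>_ _. 1)"
    using assms by (auto simp: interval_arc_coloring_def nbrs_def intro!: exI[of _ 1])
  then show ?thesis using assms unfolding interval_total_colorable_iff by blast
qed

subsection \<open>Koenig's edge coloring theorem\<close>

text \<open>A bipartite graph is a relation between a left and a right type, so the two sides stay
  apart even when the types coincide. The two conjuncts are properness at left and at right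
  vertices.\<close>

definition proper_edge_coloring :: "('a \<times> 'b) set \<Rightarrow> ('a \<Rightarrow> 'b \<Rightarrow> nat) \<Rightarrow> bool" where
  "proper_edge_coloring R c \<longleftrightarrow>
     (\<forall>x. inj_on (c x) (R `` {x})) \<and> (\<forall>y. inj_on (\<lambda>x. c x y) (R\<inverse> `` {y}))"

lemma ex_free_color:
  assumes "finite A" "card A < (D::nat)"
  shows "\<exists>a<D. a \<notin> f ` A"
proof (rule ccontr)
  assume "\<not> ?thesis"
  then have "{..<D} \<subseteq> f ` A" by auto
  then have "D \<le> card (f ` A)"
    using assms(1) card_mono by (metis card_lessThan finite_imageI)
  then show False using assms card_image_le[of A f] by linarith
qed

text \<open>
  The Kempe chain from \<open>y\<close> in the colors \<open>a\<close>, \<open>b\<close>. In a bipartite graph it can only enter the left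
  side along \<open>a\<close> and the right side along \<open>b\<close>, so it never reaches a left vertex missing \<open>a\<close>. If \<open>b\<close>
  is missing at \<open>y\<close>, the chain is the full component of \<open>y\<close>.
\<close>

inductive_set kempe :: "('a \<times> 'b) set \<Rightarrow> ('a \<Rightarrow> 'b \<Rightarrow> nat) \<Rightarrow> nat \<Rightarrow> nat \<Rightarrow> 'b \<Rightarrow> ('a + 'b) set"
  for R c a b y where
  start: "Inr y \<in> kempe R c a b y"
| left: "Inr y' \<in> kempe R c a b y \<Longrightarrow> (x', y') \<in> R \<Longrightarrow> c x' y' = a \<Longrightarrow> Inl x' \<in> kempe R c a b y"
| right: "Inl x' \<in> kempe R c a b y \<Longrightarrow> (x', y') \<in> R \<Longrightarrow> c x' y' = b \<Longrightarrow> Inr y' \<in> kempe R c a b y"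

text \<open>A left vertex enters the chain only by an edge of color \<open>a\<close>, and properness
  allows it just one such edge; so that edge has its right end in the chain too. The same holds for
  right vertices and \<open>b\<close>, except for the starting vertex \<open>y\<close>, which has no
  edge of color \<open>b\<close>.\<close>

lemma kempe_component:
  assumes c: "proper_edge_coloring R c" and b: "\<And>x. (x, y) \<in> R \<Longrightarrow> c x y \<noteq> b"
    and e: "(x', y') \<in> R" "c x' y' = a \<or> c x' y' = b"
  shows "Inl x' \<in> kempe R c a b y \<longleftrightarrow> Inr y' \<in> kempe R c a b y"
proof
  assume l: "Inl x' \<in> kempe R c a b y"
  from e(2) show "Inr y' \<in> kempe R c a b y"
  proof
    assume a: "c x' y' = a"
    from l obtain y'' where "Inr y'' \<in> kempe R c a b y" "(x', y'') \<in> R" "c x' y'' = a"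
      by (cases rule: kempe.cases) auto
    moreover from this have "y'' = y'"
      using c a e(1) by (auto simp: proper_edge_coloring_def inj_on_def)
    ultimately show ?thesis by simp
  qed (use l e in \<open>auto intro: kempe.right\<close>)
next
  assume r: "Inr y' \<in> kempe R c a b y"
  from e(2) show "Inl x' \<in> kempe R c a b y"
  proof
    assume b': "c x' y' = b"
    from r obtain x'' where "Inl x'' \<in> kempe R c a b y" "(x'', y') \<in> R" "c x'' y' = b"
      using b b' e(1) by (cases rule: kempe.cases) auto
    moreover from this have "x'' = x'"
      using c b' e(1) by (auto simp: proper_edge_coloring_def inj_on_def)
    ultimately show ?thesis by simp
  qed (use r e in \<open>auto intro: kempe.left\<close>)
qed

text \<open>Swapping \<open>a\<close> and \<open>b\<close> along the chain from \<open>y\<close>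
  frees \<open>a\<close> at \<open>y\<close>. Since \<open>x\<close> lies off the chain,
  \<open>a\<close> stays free at \<open>x\<close>, and the new edge can take it. For
  \<open>a = b\<close> the swap is the identity.\<close>

lemma proper_edge_coloring_insert:
  assumes c: "proper_edge_coloring R c" and xy: "(x, y) \<notin> R"
    and ax: "\<And>y'. (x, y') \<in> R \<Longrightarrow> c x y' \<noteq> a"
    and bY: "\<And>x'. (x', y) \<in> R \<Longrightarrow> c x' y \<noteq> b"
    and ran: "\<And>x y. (x, y) \<in> R \<Longrightarrow> c x y < D" "a < D" "b < D"
  shows "\<exists>c'. proper_edge_coloring (insert (x, y) R) c' \<and>
    (\<forall>(x, y)\<in>insert (x, y) R. c' x y < D)"
proof -
  define S where "S = kempe R c a b y"
  define sw where "sw i = (if i = a then b else if i = b then a else i)" for i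
  \<comment> \<open>Whether to swap is decided by the left end. By \<open>comp\<close> the right end
    gives the same answer for colors \<open>a\<close> and \<open>b\<close>, and \<open>sw\<close>
    fixes all others; so injectivity of \<open>sw\<close> gives properness on both sides.\<close>
  define c1 where "c1 u v = (if Inl u \<in> S then sw (c u v) else c u v)" for u v
  have comp: "Inl u \<in> S \<longleftrightarrow> Inr v \<in> S" if "(u, v) \<in> R" "c u v = a \<or> c u v = b" for u v
    unfolding S_def using kempe_component[OF c bY that] by blast
  have c1': "c1 u v = (if Inr v \<in> S then sw (c u v) else c u v)" if "(u, v) \<in> R" for u v
    using comp[OF that] by (auto simp: c1_def sw_def)
  have sw_inj: "sw i = sw j \<longleftrightarrow> i = j" for i j by (auto simp: sw_def)
  have x: "Inl x \<notin> S"
    unfolding S_def using ax by (auto elim: kempe.cases)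
  have y: "Inr y \<in> S" unfolding S_def by (rule kempe.start)
  have p1: "proper_edge_coloring R c1"
    unfolding proper_edge_coloring_def
  proof (intro conjI allI)
    fix u show "inj_on (c1 u) (R `` {u})"
      using c by (auto simp: proper_edge_coloring_def inj_on_def c1_def sw_inj)
  next
    fix v show "inj_on (\<lambda>u. c1 u v) (R\<inverse> `` {v})"
      using c by (auto simp: proper_edge_coloring_def inj_on_def c1' sw_inj)
  qed
  have ax1: "c1 x y' \<noteq> a" if "(x, y') \<in> R" for y'
    using ax[OF that] x by (simp add: c1_def)
  have ay1: "c1 x' y \<noteq> a" if "(x', y) \<in> R" for x'
    using bY[OF that] y by (auto simp: c1'[OF that] sw_def)
  define c2 where "c2 u v = (if u = x \<and> v = y then a else c1 u v)" for u v
  have "proper_edge_coloring (insert (x, y) R) c2"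
    using p1 ax1 ay1 xy unfolding proper_edge_coloring_def inj_on_def c2_def
    by (auto 4 3 split: if_splits)
  moreover have "c2 u v < D" if "(u, v) \<in> insert (x, y) R" for u v
    using that ran by (auto simp: c2_def c1_def sw_def)
  ultimately show ?thesis by blast
qed

text \<open>Induction on the edges: without the new edge both its ends have degree below
  \<open>D\<close>, so each misses one of the \<open>D\<close> colors, possibly different ones, and
  the Kempe swap reconciles them.\<close>

lemma koenig_edge_coloring:
  assumes "finite R" "\<And>x. card (R `` {x}) \<le> D" "\<And>y. card (R\<inverse> `` {y}) \<le> D"
  shows "\<exists>c. proper_edge_coloring R c \<and> (\<forall>(x, y)\<in>R. c x y < D)"
  using assms
proof (induction R rule: finite_induct)
  case empty
  then show ?case by (auto simp: proper_edge_coloring_def)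
next
  case (insert e R)
  obtain x y where e: "e = (x, y)" by fastforce
  have fin: "finite (R `` A)" "finite (R\<inverse> `` B)" for A B
    using insert(1) by (simp_all add: finite_Image)
  have "(insert e R) `` {x} = insert y (R `` {x})" "(insert e R)\<inverse> `` {y} = insert x (R\<inverse> `` {y})"
    using e by auto
  then have "card (R `` {x}) < D" "card (R\<inverse> `` {y}) < D"
    using insert.prems(1)[of x] insert.prems(2)[of y] insert(2) fin e by (auto simp: card_insert_if)
  moreover have "card (R `` {u}) \<le> D" "card (R\<inverse> `` {v}) \<le> D" for u v
    using insert.prems(1)[of u] insert.prems(2)[of v] insert(1)
    by (meson card_mono converse_mono dual_order.trans finite_Image finite_converse finite_insert
        Image_mono subset_insertI subset_refl)+
  then obtain c where c: "proper_edge_coloring R c" "\<forall>(x, y)\<in>R. c x y < D"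
    using insert.IH by blast
  obtain a b where "a < D" "a \<notin> c x ` (R `` {x})" "b < D" "b \<notin> (\<lambda>x. c x y) ` (R\<inverse> `` {y})"
    using ex_free_color fin calculation by metis
  then show ?case
    unfolding e using c insert(2) e by (intro proper_edge_coloring_insert[of R c x y a b D]) auto
qed

subsection \<open>Bipartite graphs\<close>

text \<open>Here \<open>p\<close> colors \<open>X\<close>, \<open>q\<close> colors \<open>Y\<close>,
  and \<open>c\<close> takes the end in \<open>X\<close> first. Reading \<open>c\<close> in reverse
  on arcs from \<open>Y\<close> to \<open>X\<close> makes it symmetric, so each side can be checked
  separately.\<close>

lemma bipartite_colorableI:
  assumes G: "pair_graph G" and V: "pverts G = X \<union> Y" and XY: "X \<inter> Y = {}"
    and E: "parcs G \<subseteq> X \<times> Y \<union> Y \<times> X"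
    and t: "1 \<le> t"
    and cv: "\<And>x y. x \<in> X \<Longrightarrow> y \<in> Y \<Longrightarrow> (x, y) \<in> parcs G \<Longrightarrow> p x \<noteq> q y"
    and all: "p ` X \<union> q ` Y \<union> case_prod c ` (parcs G \<inter> X \<times> Y) = {1..t :: nat}"
    and X: "\<And>x. x \<in> X \<Longrightarrow> \<exists>k. insert (p x) (c x ` nbrs G x) = {k..k + card (nbrs G x)}"
    and Y: "\<And>y. y \<in> Y \<Longrightarrow> \<exists>k. insert (q y) ((\<lambda>x. c x y) ` nbrs G y) = {k..k + card (nbrs G y)}"
  shows "G \<in> \<TT>"
proof -
  define cv where "cv v = (if v \<in> X then p v else q v)" for v
  define d where "d u v = (if u \<in> X then c u v else c v u)" for u v
  note sym = pair_graph_symD[OF G]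
  have disj: "v \<in> Y \<Longrightarrow> v \<notin> X" for v using XY by auto
  have arc: "u \<in> X \<and> v \<in> Y \<or> v \<in> X \<and> u \<in> Y" if "(u, v) \<in> parcs G" for u v
    using that E by blast
  have dcv: "d u v = d v u \<and> cv u \<noteq> cv v" if uv: "(u, v) \<in> parcs G" for u v
    using arc[OF uv] cv[OF _ _ uv] cv[OF _ _ sym[OF uv]] disj
    by (fastforce simp: d_def cv_def)
  have "case_prod d ` parcs G = case_prod c ` (parcs G \<inter> X \<times> Y)"
  proof
    have "d u v \<in> case_prod c ` (parcs G \<inter> X \<times> Y)" if uv: "(u, v) \<in> parcs G" for u v
    proof (cases "u \<in> X")
      case True
      then have "(u, v) \<in> parcs G \<inter> X \<times> Y" using arc[OF uv] uv disj by blast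
      from imageI[OF this, of "case_prod c"] show ?thesis using True by (simp add: d_def)
    next
      case False
      then have "(v, u) \<in> parcs G \<inter> X \<times> Y" using arc[OF uv] sym[OF uv] disj by blast
      from imageI[OF this, of "case_prod c"] show ?thesis using False by (simp add: d_def)
    qed
    then show "case_prod d ` parcs G \<subseteq> case_prod c ` (parcs G \<inter> X \<times> Y)" by auto
    show "case_prod c ` (parcs G \<inter> X \<times> Y) \<subseteq> case_prod d ` parcs G"
      by (force simp: d_def)
  qed
  moreover have "cv ` pverts G = p ` X \<union> q ` Y"
    unfolding V image_Un using disj by (auto simp: cv_def)
  ultimately have "cv ` pverts G \<union> case_prod d ` parcs G = {1..t}" using all by simp
  moreover have "\<exists>k. insert (cv v) (d v ` nbrs G v) = {k..k + card (nbrs G v)}"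
    if "v \<in> pverts G" for v
  proof (cases "v \<in> X")
    case True
    then have "d v ` nbrs G v = c v ` nbrs G v" by (simp add: d_def)
    then show ?thesis using X[OF True] True by (simp add: cv_def)
  next
    case False
    then have "d v ` nbrs G v = (\<lambda>x. c x v) ` nbrs G v" by (simp add: d_def)
    then show ?thesis using Y[of v] False that V by (simp add: cv_def)
  qed
  ultimately have "interval_arc_coloring G t cv d"
    using dcv unfolding interval_arc_coloring_def by blast
  then show ?thesis using G t unfolding interval_total_colorable_iff by blast
qed

lemma regular_bipartite_colorable:
  assumes G: "pair_graph G" and ne: "pverts G \<noteq> {}" and "regular G" "bipartite G"
  shows "G \<in> \<TT>"
proof -
  obtain r where r: "\<And>v. v \<in> pverts G \<Longrightarrow> card (nbrs G v) = r"
    using \<open>regular G\<close> degree_eq[OF G] by (auto simp: regular_def)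
  obtain X Y where V: "pverts G = X \<union> Y" and XY: "X \<inter> Y = {}"
    and E: "parcs G \<subseteq> X \<times> Y \<union> Y \<times> X"
    using \<open>bipartite G\<close> unfolding bipartite_def by blast
  note sym = pair_graph_symD[OF G]
  show ?thesis
  proof (cases "r = 0")
    case True
    then have nb: "nbrs G v = {}" if "v \<in> pverts G" for v
      using r[OF that] finite_nbrs[OF G, of v] by simp
    have "parcs G = {}"
    proof (rule ccontr)
      assume "parcs G \<noteq> {}"
      then obtain u v where "(u, v) \<in> parcs G" by auto
      then show False using nb[of u] pair_graph_vertsD(1)[OF G] by (auto simp: nbrs_def)
    qed
    with G ne show ?thesis by (rule edgeless_colorable)
  next
    case False
    define R where "R = parcs G \<inter> X \<times> Y"
    have RX: "R `` {x} = nbrs G x" if "x \<in> X" for x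
      using that E XY by (auto simp: R_def nbrs_def)
    have RY: "R\<inverse> `` {y} = nbrs G y" if "y \<in> Y" for y
      using that E XY sym by (auto simp: R_def nbrs_def)
    have "card (R `` {x}) \<le> r" for x
      using RX[of x] r[of x] V by (cases "x \<in> X") (auto simp: R_def Image_def)
    moreover have "card (R\<inverse> `` {y}) \<le> r" for y
      using RY[of y] r[of y] V by (cases "y \<in> Y") (auto simp: R_def Image_def)
    moreover have "finite R" using pair_graph_finite(2)[OF G] by (simp add: R_def)
    ultimately obtain c where c: "proper_edge_coloring R c" and ran: "\<forall>(x, y)\<in>R. c x y < r"
      using koenig_edge_coloring by blast
    \<comment> \<open>An injection of an \<open>r\<close>-element set into \<open>r\<close> colors
      is onto, so every vertex meets all \<open>r\<close> edge colors.\<close>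
    have full: "f ` A = {..<r}" if "inj_on f A" "card A = r" "f ` A \<subseteq> {..<r}" for f :: "'a \<Rightarrow> nat" and A
      using that card_subset_eq[of "{..<r}" "f ` A"] by (simp add: card_image)
    have X: "c x ` nbrs G x = {..<r}" if "x \<in> X" for x
    proof (rule full)
      show "inj_on (c x) (nbrs G x)"
        using c RX[OF that] unfolding proper_edge_coloring_def by metis
      show "card (nbrs G x) = r" using that r V by simp
      show "c x ` nbrs G x \<subseteq> {..<r}"
        using ran unfolding RX[OF that, symmetric] by auto
    qed
    have Y: "(\<lambda>x. c x y) ` nbrs G y = {..<r}" if "y \<in> Y" for y
    proof (rule full)
      show "inj_on (\<lambda>x. c x y) (nbrs G y)"
        using c RY[OF that] unfolding proper_edge_coloring_def by metis
      show "card (nbrs G y) = r" using that r V by simp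
      show "(\<lambda>x. c x y) ` nbrs G y \<subseteq> {..<r}"
        using ran unfolding RY[OF that, symmetric] by auto
    qed
    have ex_nbr: "nbrs G v \<noteq> {}" if "v \<in> pverts G" for v
      using r[OF that] False by auto
    \<comment> \<open>With \<open>r > 0\<close> every vertex has a neighbor on the other side;
      nonempty sides guarantee that the colors 1 and \<open>r + 2\<close> occur.\<close>
    have nX: "X \<noteq> {}" and nY: "Y \<noteq> {}"
      using ex_nbr ne V E XY by (fastforce simp: nbrs_def)+
    have img: "case_prod c ` R = {..<r}"
    proof
      show "case_prod c ` R \<subseteq> {..<r}" using ran by auto
      obtain x where x: "x \<in> X" using nX by blast
      show "{..<r} \<subseteq> case_prod c ` R"
        unfolding X[OF x, symmetric] RX[OF x, symmetric] by auto
    qed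
    have shift: "(\<lambda>i. i + 2) ` {..<r} = {2..r + 1}"
    proof (intro set_eqI iffI)
      fix i assume "i \<in> {2..r + 1}"
      then have "i - 2 \<in> {..<r}" "i = i - 2 + 2" by auto
      then show "i \<in> (\<lambda>i. i + 2) ` {..<r}" by (rule rev_image_eqI)
    qed auto
    \<comment> \<open>Koenig's colors start at 0, and adding 2 leaves room for color 1 below them.
      Vertices of \<open>X\<close> then see \<open>{1..r + 1}\<close>, those of \<open>Y\<close> see
      \<open>{2..r + 2}\<close>.\<close>
    show ?thesis
    proof (rule bipartite_colorableI[OF G V XY E, where t = "r + 2" and p = "\<lambda>_. 1"
          and q = "\<lambda>_. r + 2" and c = "\<lambda>x y. c x y + 2"])
      have "(\<lambda>(x, y). c x y + 2) ` R = {2..r + 1}"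
        unfolding shift[symmetric] img[symmetric] image_image by (simp add: case_prod_unfold)
      then show "(\<lambda>_. 1) ` X \<union> (\<lambda>_. r + 2) ` Y \<union> (\<lambda>(x, y). c x y + 2) ` (parcs G \<inter> X \<times> Y) = {1..r + 2}"
        using nX nY by (auto simp: R_def)
    next
      fix x assume x: "x \<in> X"
      have "(\<lambda>y. c x y + 2) ` nbrs G x = {2..r + 1}"
        unfolding shift[symmetric] X[OF x, symmetric] image_image ..
      then show "\<exists>k. insert 1 ((\<lambda>y. c x y + 2) ` nbrs G x) = {k..k + card (nbrs G x)}"
        using r x V by (intro exI[of _ 1]) auto
    next
      fix y assume y: "y \<in> Y"
      have "(\<lambda>x. c x y + 2) ` nbrs G y = {2..r + 1}"
        unfolding shift[symmetric] Y[OF y, symmetric] image_image ..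
      then show "\<exists>k. insert (r + 2) ((\<lambda>x. c x y + 2) ` nbrs G y) = {k..k + card (nbrs G y)}"
        using r y V by (intro exI[of _ 2]) auto
    qed auto
  qed
qed

section \<open>Complete bipartite graphs\<close>

lemma ex_enumeration:
  assumes "card A = n" "1 \<le> n"
  shows "\<exists>f :: 'a \<Rightarrow> nat. f ` A = {1..n}"
proof -
  have "finite A" using assms by (metis card.infinite not_one_le_zero)
  then obtain f where "bij_betw f A {1..n}"
    using assms(1) finite_same_card_bij[of A "{1..n}"] by auto
  then show ?thesis by (auto simp: bij_betw_def)
qed

text \<open>The edges at \<open>u\<close> have the colors \<open>f u + 1\<close> to
  \<open>f u + n\<close>, and \<open>f u\<close> fits just below. Those at \<open>v\<close> have the
  colors \<open>g v + 1\<close> to \<open>g v + m\<close>, and \<open>g v + (m + 1)\<close> fits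
  just above.\<close>

lemma complete_bipartite_colorable:
  assumes mn: "1 \<le> m" "1 \<le> n" and K: "complete_bipartite_digraph m n (with_proj G)"
  shows "G \<in> \<TT>"
proof -
  have G: "pair_graph G" using K by (rule pair_graphI_complete_bipartite)
  obtain U V where UV: "pverts G = U \<union> V" "U \<inter> V = {}" and card: "card U = m" "card V = n"
    and E: "parcs G = U \<times> V \<union> V \<times> U"
    using K unfolding complete_bipartite_digraph_pair_def by blast
  obtain f g where f: "f ` U = {1..m}" and g: "g ` V = {1..n}"
    using ex_enumeration[OF card(1) mn(1)] ex_enumeration[OF card(2) mn(2)] by blast
  have nU: "nbrs G u = V" if "u \<in> U" for u using that UV(2) E by (auto simp: nbrs_def)
  have nV: "nbrs G v = U" if "v \<in> V" for v using that UV(2) E by (auto simp: nbrs_def)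
  have fb: "1 \<le> f u \<and> f u \<le> m" if "u \<in> U" for u using f that by (metis atLeastAtMost_iff imageI)
  have gb: "1 \<le> g v \<and> g v \<le> n" if "v \<in> V" for v using g that by (metis atLeastAtMost_iff imageI)
  have fE: "\<exists>u\<in>U. f u = i" if "1 \<le> i" "i \<le> m" for i
    using f that by (metis atLeastAtMost_iff imageE)
  have gE: "\<exists>v\<in>V. g v = i" if "1 \<le> i" "i \<le> n" for i
    using g that by (metis atLeastAtMost_iff imageE)
  have shift: "(\<lambda>i. i + k) ` {1..l} = {k + 1..k + l}" for k l :: nat
    by (simp add: add.commute)
  show ?thesis
  proof (rule bipartite_colorableI[OF G UV, where t = "m + n + 1" and p = f
        and q = "\<lambda>v. g v + (m + 1)" and c = "\<lambda>u v. f u + g v"])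
    have Gi: "(\<lambda>v. g v + (m + 1)) ` V = {m + 2..m + n + 1}"
      using shift[of "m + 1" n] unfolding g[symmetric] image_image by simp
    have "parcs G \<inter> U \<times> V = U \<times> V" using E by auto
    moreover have "(\<lambda>(u, v). f u + g v) ` (U \<times> V) \<subseteq> {1..m + n + 1}"
      using fb gb by (force dest: add_mono)
    moreover have split: "{1..m + n + 1} = insert (m + 1) ({1..m} \<union> {m + 2..m + n + 1})" by auto
    \<comment> \<open>The vertices use every color up to \<open>m + n + 1\<close> except
      \<open>m + 1\<close>, which occurs on the edge joining the last vertex of \<open>U\<close> to
      the first of \<open>V\<close>.\<close>
    moreover have "m + 1 \<in> (\<lambda>(u, v). f u + g v) ` (U \<times> V)"
    proof -
      obtain u v where "u \<in> U" "f u = m" "v \<in> V" "g v = 1"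
        using fE[of m] gE[of 1] mn by auto
      then show ?thesis by (force simp: image_iff)
    qed
    ultimately show "f ` U \<union> (\<lambda>v. g v + (m + 1)) ` V \<union>
        (\<lambda>(u, v). f u + g v) ` (parcs G \<inter> U \<times> V) = {1..m + n + 1}"
      unfolding f Gi split by auto
  next
    fix u assume u: "u \<in> U"
    have "(\<lambda>v. f u + g v) ` V = {f u + 1..f u + n}"
      using shift[of "f u" n] unfolding g[symmetric] image_image by (simp add: add.commute)
    then show "\<exists>k. insert (f u) ((\<lambda>v. f u + g v) ` nbrs G u) = {k..k + card (nbrs G u)}"
      using card mn by (intro exI[of _ "f u"]) (auto simp: nU[OF u])
  next
    fix v assume v: "v \<in> V"
    have "(\<lambda>u. f u + g v) ` U = {g v + 1..g v + m}"
      using shift[of "g v" m] unfolding f[symmetric] image_image .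
    then show "\<exists>k. insert (g v + (m + 1)) ((\<lambda>u. f u + g v) ` nbrs G v) = {k..k + card (nbrs G v)}"
      using card mn by (intro exI[of _ "g v + 1"]) (auto simp: nV[OF v])
  next
    fix u v assume "u \<in> U" "v \<in> V"
    then show "f u \<noteq> g v + (m + 1)" using fb[of u] by linarith
  qed (use E in auto)
qed

subsection \<open>Trees\<close>

text \<open>The leaf \<open>u\<close> sees \<open>{s + 1, s + 2}\<close>, the interval at
  \<open>v\<close> grows by one at its upper end, and all other vertices see what they saw
  before.\<close>

lemma colorable_add_leaf:
  assumes H: "H \<in> \<TT>" and u: "u \<notin> pverts H" and v: "v \<in> pverts H"
    and V: "pverts G = insert u (pverts H)" and E: "parcs G = parcs H \<union> {(u, v), (v, u)}"
  shows "G \<in> \<TT>"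
proof -
  obtain t cv c where pg: "pair_graph H" and t: "1 \<le> t"
    and col: "interval_arc_coloring H t cv c"
    using H unfolding interval_total_colorable_iff by blast
  have sym: "c u v = c v u" and cv: "cv u \<noteq> cv v" if "(u, v) \<in> parcs H" for u v
    using col that unfolding interval_arc_coloring_def by blast+
  have all: "cv ` pverts H \<union> case_prod c ` parcs H = {1..t}"
    and int: "\<And>v. v \<in> pverts H \<Longrightarrow>
      \<exists>k. insert (cv v) (c v ` nbrs H v) = {k..k + card (nbrs H v)}"
    using col unfolding interval_arc_coloring_def by blast+
  note verts = pair_graph_vertsD[OF pg]
  have uv: "u \<noteq> v" using u v by auto
  have G: "pair_graph G"
  proof (rule pair_graphI)
    show "finite (pverts G)" using pair_graph_finite(1)[OF pg] V by simp
    show "parcs G \<subseteq> pverts G \<times> pverts G" using verts v unfolding V E by auto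
    show "(y, x) \<in> parcs G" if "(x, y) \<in> parcs G" for x y
      using that pair_graph_symD[OF pg, of x y] unfolding E by blast
    show "(x, x) \<notin> parcs G" for x
      using pair_graph_irreflD[OF pg, of x] uv unfolding E by blast
  qed
  obtain k where k: "insert (cv v) (c v ` nbrs H v) = {k..k + card (nbrs H v)}"
    using int[OF v] by blast
  define s where "s = k + card (nbrs H v)"
  have "s \<in> insert (cv v) (c v ` nbrs H v)" unfolding k s_def by simp
  then have "s \<in> {1..t}" unfolding all[symmetric] using v by (force simp: nbrs_def)
  \<comment> \<open>This separates the color of \<open>v\<close> from the color \<open>s + 2\<close>
    of the leaf.\<close>
  have cvs: "cv v \<le> s" using k unfolding s_def by (metis atLeastAtMost_iff insertI1)
  define cv' where "cv' = cv(u := s + 2)"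
  define c' where "c' x y = (if x = u \<or> y = u then s + 1 else c x y)" for x y
  \<comment> \<open>Since \<open>s \<le> t\<close>, adding \<open>s + 1\<close> and
    \<open>s + 2\<close> to \<open>{1..t}\<close> leaves no gap; the maximum covers the case that
    both colors were already in use.\<close>
  define t' where "t' = max t (s + 2)"
  have noarc: "(u, w) \<notin> parcs H" "(w, u) \<notin> parcs H" for w using verts u by blast+
  have 1: "c' x y = c' y x \<and> cv' x \<noteq> cv' y" if "(x, y) \<in> parcs G" for x y
    using that noarc uv cvs sym[of x y] cv[of x y] unfolding E by (auto simp: c'_def cv'_def)
  have "cv' ` pverts G = insert (s + 2) (cv ` pverts H)"
    unfolding V using u by (auto simp: cv'_def image_iff)
  moreover have "case_prod c' ` parcs G = insert (s + 1) (case_prod c ` parcs H)"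
  proof -
    have "case_prod c' ` parcs H = case_prod c ` parcs H"
      using noarc by (intro image_cong) (auto simp: c'_def)
    then show ?thesis unfolding E by (simp add: image_Un c'_def)
  qed
  ultimately have 2: "cv' ` pverts G \<union> case_prod c' ` parcs G = insert (s + 1) (insert (s + 2) {1..t})"
    unfolding all[symmetric] by auto
  also have "\<dots> = {1..t'}" using \<open>s \<in> {1..t}\<close> by (auto simp: t'_def)
  finally have 2: "cv' ` pverts G \<union> case_prod c' ` parcs G = {1..t'}" .
  have 3: "\<exists>k. insert (cv' w) (c' w ` nbrs G w) = {k..k + card (nbrs G w)}" if w: "w \<in> pverts G" for w
  proof -
    consider "w = u" | "w = v" | "w \<in> pverts H" "w \<noteq> u" "w \<noteq> v"
      using w unfolding V by blast
    then show ?thesis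
    proof cases
      case 1
      then have "nbrs G w = {v}" using noarc E by (auto simp: nbrs_def)
      then show ?thesis using 1 by (intro exI[of _ "s + 1"]) (auto simp: cv'_def c'_def)
    next
      case 2
      have nb: "nbrs G v = insert u (nbrs H v)" "u \<notin> nbrs H v"
        using noarc E uv by (auto simp: nbrs_def)
      have "c' v ` nbrs H v = c v ` nbrs H v"
        using nb(2) uv by (intro image_cong) (auto simp: c'_def)
      then have "insert (cv' v) (c' v ` nbrs G v) = insert (s + 1) {k..s}"
        using nb uv k by (auto simp: cv'_def c'_def s_def)
      also have "\<dots> = {k..k + card (nbrs G v)}"
        using nb finite_nbrs[OF pg] by (auto simp: s_def)
      finally show ?thesis using 2 by blast
    next
      case 3
      then have nb: "nbrs G w = nbrs H w" "u \<notin> nbrs H w"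
        using noarc E by (auto simp: nbrs_def)
      have "c' w ` nbrs H w = c w ` nbrs H w"
        using nb(2) 3 by (intro image_cong) (auto simp: c'_def)
      then show ?thesis using int[OF 3(1)] 3 nb by (simp add: cv'_def)
    qed
  qed
  have "interval_arc_coloring G t' cv' c'"
    using 1 2 3 unfolding interval_arc_coloring_def by blast
  moreover have "1 \<le> t'" using t by (simp add: t'_def)
  ultimately show ?thesis using G unfolding interval_total_colorable_iff by blast
qed

text \<open>The path is closed up through \<open>u\<close>. As \<open>v \<noteq> w\<close>, it has
  at least one arc, so with the two arcs at \<open>u\<close> the cycle has length at least 3 and is
  a genuine undirected cycle.\<close>

lemma (in pair_graph) cycle_through_outer_vertex:
  assumes p: "apath v p w" and "v \<noteq> w" and u: "u \<notin> set (pawalk_verts v p)"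
    and uv: "(u, v) \<in> parcs G" and wu: "(w, u) \<in> parcs G"
  shows "\<exists>q. cycle q \<and> 3 \<le> length q"
proof (intro exI conjI)
  have aw: "awalk v p w" and dist: "distinct (pawalk_verts v p)"
    using p by (auto simp: apath_def)
  have pne: "p \<noteq> []" using aw \<open>v \<noteq> w\<close> by (auto simp: awalk_Nil_iff)
  let ?q = "(u, v) # p @ [(w, u)]"
  have tail: "awalk w [(w, u)] u" using wu by (simp add: awalk_Cons_iff awalk_Nil_iff in_arcsD2)
  have "awalk v (p @ [(w, u)]) u" using aw tail by (rule awalk_appendI)
  then have "awalk u ?q u" using uv by (simp add: awalk_Cons_iff del: awalk_append_iff)
  moreover have "pawalk_verts v (p @ [(w, u)]) = pawalk_verts v p @ [u]"
    using awalk_verts_append[OF \<open>awalk v (p @ [(w, u)]) u\<close>] aw by auto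
  ultimately show "cycle ?q" using dist u unfolding cycle_def by (auto intro!: exI[of _ u])
  show "3 \<le> length ?q" using pne by (cases p) auto
qed

definition induced :: "'a pair_pre_digraph \<Rightarrow> 'a set \<Rightarrow> 'a pair_pre_digraph" where
  "induced G S = \<lparr>pverts = S, parcs = parcs G \<inter> S \<times> S\<rparr>"

text \<open>Connectedness of the part of the graph on \<open>S\<close>, phrased with paths of the
  whole graph confined to \<open>S\<close>, so that they can be closed to cycles of the whole graph
  directly.\<close>

definition (in pair_pre_digraph) path_linked :: "'a set \<Rightarrow> bool" where
  "path_linked S \<longleftrightarrow> (\<forall>v\<in>S. \<forall>w\<in>S. \<exists>p. apath v p w \<and> set (pawalk_verts v p) \<subseteq> S)"

text \<open>Connectedness supplies an outer vertex \<open>u\<close> adjacent to some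
  \<open>v\<close> in \<open>S\<close>. A second neighbor of \<open>u\<close> in \<open>S\<close>
  would be joined to \<open>v\<close> inside \<open>S\<close> and produce a cycle through
  \<open>u\<close>; hence \<open>u\<close> is attached as a leaf.\<close>

lemma (in pair_graph) tree_grow:
  assumes conn: "\<And>u v. u \<in> pverts G \<Longrightarrow> v \<in> pverts G \<Longrightarrow> (u, v) \<in> (parcs G)\<^sup>*"
    and acyc: "\<not> (\<exists>p. cycle p \<and> 3 \<le> length p)"
    and S: "S \<subseteq> pverts G" "S \<noteq> {}" "S \<noteq> pverts G" and col: "induced G S \<in> \<TT>"
    and linked: "path_linked S"
  shows "\<exists>u. u \<in> pverts G - S \<and> induced G (insert u S) \<in> \<TT> \<and> path_linked (insert u S)"
proof -
  have path: "\<exists>p. apath v p w \<and> set (pawalk_verts v p) \<subseteq> S" if "v \<in> S" "w \<in> S" for v w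
    using linked that unfolding path_linked_def by blast
  have "pair_graph G" by unfold_locales
  note sym = pair_graph_symD[OF this] and irr = pair_graph_irreflD[OF this]
  obtain a b where a: "a \<in> S" and b: "b \<in> pverts G" "b \<notin> S" using S by blast
  have "(a, b) \<in> (parcs G)\<^sup>*" using conn a b S by blast
  \<comment> \<open>A walk from inside \<open>S\<close> to outside must cross the boundary
    somewhere.\<close>
  then have "\<exists>v u. v \<in> S \<and> u \<notin> S \<and> (v, u) \<in> parcs G"
    using a b(2) by (induction rule: rtrancl_induct) auto
  then obtain v u where v: "v \<in> S" and u: "u \<notin> S" and vu: "(v, u) \<in> parcs G" by blast
  have uG: "u \<in> pverts G" using vu by (rule in_arcsD2)
  have uniq: "w = v" if "w \<in> S" "(w, u) \<in> parcs G" for w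
  proof (rule ccontr)
    assume "w \<noteq> v"
    obtain p where "apath v p w" "set (pawalk_verts v p) \<subseteq> S" using path v \<open>w \<in> S\<close> by blast
    then show False
      using cycle_through_outer_vertex[of v p w u] acyc \<open>w \<noteq> v\<close> u sym[OF vu] that(2) by blast
  qed
  have "parcs G \<inter> insert u S \<times> insert u S = parcs G \<inter> S \<times> S \<union> {(u, v), (v, u)}"
    using uniq sym vu v irr by blast
  then have "induced G (insert u S) \<in> \<TT>"
    by (intro colorable_add_leaf[OF col]) (use u v in \<open>auto simp: induced_def\<close>)
  moreover have "\<exists>p. apath x p y \<and> set (pawalk_verts x p) \<subseteq> insert u S"
    if xy: "x \<in> insert u S" "y \<in> insert u S" for x y
  proof -
    consider "x = u" "y = u" | "x = u" "y \<in> S" | "x \<in> S" "y = u" | "x \<in> S" "y \<in> S"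
      using xy by blast
    then show ?thesis
    proof cases
      case 1
      then show ?thesis using uG by (intro exI[of _ "[]"]) (auto simp: apath_Nil_iff)
    next
      case 2
      then obtain p where "apath v p y" "set (pawalk_verts v p) \<subseteq> S" using path v by blast
      then show ?thesis using 2 u sym[OF vu]
        by (intro exI[of _ "(u, v) # p"]) (auto simp: apath_Cons_iff)
    next
      case 3
      then obtain p where p: "apath x p v" "set (pawalk_verts x p) \<subseteq> S" using path v by blast
      then have "awalk x p v" by (simp add: apath_def)
      moreover have "awalk v [(v, u)] u" using vu uG by (simp add: awalk_Cons_iff awalk_Nil_iff)
      ultimately have aw: "awalk x (p @ [(v, u)]) u" by (rule awalk_appendI)
      then have "pawalk_verts x (p @ [(v, u)]) = pawalk_verts x p @ [u]"
        using awalk_verts_append[OF aw] \<open>awalk x p v\<close> by auto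
      then show ?thesis using 3 aw p u by (intro exI[of _ "p @ [(v, u)]"]) (auto simp: apath_def)
    next
      case 4
      then show ?thesis using path by blast
    qed
  qed
  ultimately show ?thesis using u uG unfolding path_linked_def by blast
qed

text \<open>A colored, path-linked vertex set is grown from a single vertex, one leaf at a time,
  until it contains all vertices.\<close>

lemma tree_colorable:
  assumes G: "pair_graph G" and T: "undirected_tree G"
  shows "G \<in> \<TT>"
proof -
  interpret pair_graph G by (rule G)
  \<comment> \<open>\<open>connected\<close> refers to the symmetric closure; the arcs are already
    symmetric, so reachability is the same in \<open>G\<close> itself.\<close>
  have "strongly_connected (with_proj (mk_symmetric (with_proj G)))"
    using T unfolding undirected_tree_def connected_def by (rule conjunct1)
  moreover have "u \<rightarrow>\<^sup>*\<^bsub>mk_symmetric (with_proj G)\<^esub> v \<longleftrightarrow> u \<rightarrow>\<^sup>*\<^bsub>with_proj G\<^esub> v" for u v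
    by (rule reachable_mk_symmetric_eq[OF sym_arcs])
  ultimately have ne: "pverts G \<noteq> {}"
    and reach: "\<And>u v. u \<in> pverts G \<Longrightarrow> v \<in> pverts G \<Longrightarrow> u \<rightarrow>\<^sup>*\<^bsub>with_proj G\<^esub> v"
    unfolding strongly_connected_def with_proj_simps pverts_mk_symmetric by blast+
  have conn: "(u, v) \<in> (parcs G)\<^sup>*" if "u \<in> pverts G" "v \<in> pverts G" for u v
    using reachable_rtranclI[OF reach[OF that]] by simp
  have acyc: "\<not> (\<exists>p. cycle p \<and> 3 \<le> length p)" using T unfolding undirected_tree_def by (rule conjunct2)
  have "\<exists>S. S \<subseteq> pverts G \<and> card S = Suc n \<and> induced G S \<in> \<TT> \<and> path_linked S"
    if "Suc n \<le> card (pverts G)" for n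
    using that
  proof (induction n)
    case 0
    obtain r where r: "r \<in> pverts G" using ne by blast
    have p: "parcs (induced G {r}) = {}" "pverts (induced G {r}) = {r}"
      using pair_graph_irreflD[OF G] by (auto simp: induced_def)
    then have "induced G {r} \<in> \<TT>"
      by (intro edgeless_colorable pair_graphI) auto
    then show ?case using r
      by (intro exI[of _ "{r}"]) (auto intro!: exI[of _ "[]"] simp: path_linked_def apath_Nil_iff)
  next
    case (Suc n)
    from Suc.prems have "Suc n \<le> card (pverts G)" by simp
    then obtain S where S: "S \<subseteq> pverts G" "card S = Suc n" "induced G S \<in> \<TT>" "path_linked S"
      using Suc.IH by blast
    have "S \<noteq> {}" "S \<noteq> pverts G" using Suc.prems S(2) by auto
    from tree_grow[OF conn acyc S(1) this S(3,4)] obtain u where u: "u \<in> pverts G" "u \<notin> S"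
      "induced G (insert u S) \<in> \<TT>" "path_linked (insert u S)" by blast
    have "finite S" using S(1) pair_finite_verts by (rule finite_subset)
    then have "card (insert u S) = Suc (Suc n)" using S(2) u(2) by simp
    then show ?case using S(1) u by (intro exI[of _ "insert u S"] conjI) auto
  qed
  \<comment> \<open>Taking \<open>n\<close> one below the number of vertices forces \<open>S\<close>
    to be the whole vertex set; nonemptiness makes the subtraction exact.\<close>
  moreover have "Suc (card (pverts G) - 1) = card (pverts G)"
    using ne pair_finite_verts card_gt_0_iff[of "pverts G"] by simp
  ultimately obtain S where
    S: "S \<subseteq> pverts G" "card S = card (pverts G)" "induced G S \<in> \<TT>"
    by (metis order_refl)
  then have "S = pverts G" using pair_finite_verts card_subset_eq by blast
  moreover have "induced G (pverts G) = G"
    using pair_graph_vertsD[OF G] by (auto simp: induced_def intro!: pair_pre_digraph.equality)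
  ultimately show ?thesis using S(3) by simp
qed

theorem theorem6:
  shows "(\<forall>G :: 'a pair_pre_digraph.
            pair_graph G \<and> pverts G \<noteq> {} \<and> regular G \<and> bipartite G \<longrightarrow> G \<in> \<TT>) \<and>
         (\<forall>G :: 'a pair_pre_digraph. pair_graph G \<and> undirected_tree G \<longrightarrow> G \<in> \<TT>) \<and>
         (\<forall>(G :: 'a pair_pre_digraph) m n.
            1 \<le> m \<and> 1 \<le> n \<and> complete_bipartite_digraph m n (with_proj G) \<longrightarrow> G \<in> \<TT>)"
  using regular_bipartite_colorable tree_colorable complete_bipartite_colorable by blast

end
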